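(* Let $x_0\in\mathbb{R}^d$ be an input, let $m\in[0,1]^d$ be a saliency map of $x_0$, and let $L(x,m)=-\log f(m\odot x)$. Let $\mathcal{D}=\{x_i\}$ be the vicinity of $x_0$ such that $\Vert x_i-x_0\Vert\le\epsilon$, where $\epsilon$ is a small positive number. Define $$g(x)=-\nabla L(x,m)=\nabla\log f(m\odot x),$$ and write $x_i=x_0+\alpha v$ with $\alpha=\Vert x_i-x_0\Vert$ and $\Vert v\Vert=1$. Then the distance between the gradients of the explanations of $x_i$ and $x_0$ is bounded as follows: $$\Vert\nabla L(x_i,m)-\nabla L(x_0,m)\Vert\ \le\ \Vert m\Vert_1\cdot\Vert -g(x_0+\alpha v)+g(x_0)\Vert .$$
   Context: $\Vert\cdot\Vert$ is the Euclidean norm on $\mathbb{R}^d$, $\Vert\cdot\Vert_1$ the $\ell_1$-norm, and $\odot$ the element-wise product of vectors. $\nabla L(x,m)$ denotes the gradient of $L(\cdot,m)$ at $x$. $f(x)\in[0,1]$ is the softmax probability that a neural-network classifier assigns to the target class at input $x$; the saliency map $m$ represents the importance of the individual features (pixels) of $x_0$ for the prediction; $L(x,m)=-\log f(m\odot x)$ is the cross-entropy loss of classifying $m\odot x$ as the target class.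
   Formalization: Here g(x) is the gradient of log f evaluated at the point m⊙x, not −∇L(x,m), which is m⊙g(x); with g = −∇L the bound fails when ‖m‖₁<1 and the gradients differ (d=1, m=1/2, f logistic sigmoid). f is assumed differentiable at the masked points m⊙x used. *)

theory Defs
  imports "HOL-Analysis.Analysis"
begin

text \<open>
  The element-wise product of vectors is the library's multiplication on \<open>real ^ 'd\<close>, for which
  \<open>(x * y) $ i = x $ i * y $ i\<close>.
\<close>

text \<open>
  Only meaningful at points where the function is differentiable,
  \<open>gradient\<close> picks out the vector \<open>D\<close> with \<open>GDERIV F x :> D\<close>, which is then unique.
\<close>

definition gradient :: "('a::real_inner \<Rightarrow> real) \<Rightarrow> 'a \<Rightarrow> 'a" where
  "gradient F x = (THE D. GDERIV F x :> D)"

definition l1_norm :: "real ^ 'd \<Rightarrow> real" where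
  "l1_norm x = (\<Sum>i\<in>UNIV. \<bar>x $ i\<bar>)"

definition softmax :: "real ^ 'k \<Rightarrow> real ^ 'k" where
  "softmax z = (\<chi> i. exp (z $ i) / (\<Sum>j\<in>UNIV. exp (z $ j)))"

definition loss :: "(real ^ 'd \<Rightarrow> real) \<Rightarrow> real ^ 'd \<Rightarrow> real ^ 'd \<Rightarrow> real" where
  "loss f x m = - ln (f (m * x))"

text \<open>
  The gradient of \<open>log f\<close>, taken with respect to the argument of \<open>f\<close> and evaluated at the masked
  input \<open>m * x\<close>. The gradient of \<open>\<lambda>x. loss f x m\<close> carries in addition the factor \<open>- m\<close> from the
  chain rule: at points of differentiability it equals \<open>- (m * masked_log_grad f m x)\<close>.
\<close>

definition masked_log_grad :: "(real ^ 'd \<Rightarrow> real) \<Rightarrow> real ^ 'd \<Rightarrow> real ^ 'd \<Rightarrow> real ^ 'd" where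
  "masked_log_grad f m x = gradient (\<lambda>y. ln (f y)) (m * x)"

end

theory Submission
  imports Defs
begin

text \<open>
  By the chain rule, multiplying the argument by \<open>m\<close> multiplies the gradient by \<open>m\<close>. The operator
  \<open>w \<mapsto> m * w\<close> is diagonal, so its operator norm is \<open>max\<^sub>j \<bar>m\<^sub>j\<bar>\<close>, which is at most
  the \<open>\<ell>\<^sub>1\<close>-norm of \<open>m\<close>.
\<close>

text \<open>The derivative at a point is unique, and a vector is determined by its inner products
  with all vectors, so the description in \<open>gradient\<close> has exactly one witness.\<close>

lemma gradient_eqI:
  assumes "GDERIV F x :> D"
  shows "gradient F x = D"
  unfolding gradient_def
proof (rule the_equality)
  fix E assume "GDERIV F x :> E"
  with assms have "(\<lambda>h. h \<bullet> E) = (\<lambda>h. h \<bullet> D)"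
    unfolding gderiv_def by (rule has_derivative_unique[rotated])
  then show "E = D"
    by (metis vector_eq_ldot)
qed (fact assms)

text \<open>Riesz representation in finite dimension: a linear functional \<open>F'\<close>
  satisfies \<open>F' h = F' h * 1\<close>, and the adjoint moves \<open>F'\<close> onto the 1,
  which yields the representing vector.\<close>

lemma GDERIV_gradient:
  fixes F :: "'a::euclidean_space \<Rightarrow> real"
  assumes "F differentiable at x"
  shows "GDERIV F x :> gradient F x"
proof -
  from assms obtain F' where F': "(F has_derivative F') (at x)"
    unfolding differentiable_def by blast
  then have "linear F'"
    by (rule has_derivative_linear)
  then have "F' = (\<lambda>h. h \<bullet> adjoint F' 1)"
    by (simp add: adjoint_works fun_eq_iff)
  with F' have "GDERIV F x :> adjoint F' 1"
    unfolding gderiv_def by simp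
  then show ?thesis
    using gradient_eqI by metis
qed

lemma GDERIV_compose_times:
  fixes F :: "real ^ 'n \<Rightarrow> real"
  assumes "GDERIV F (m * x) :> D"
  shows "GDERIV (\<lambda>y. F (m * y)) x :> m * D"
proof -
  have "linear ((*) m)"
    by (rule linearI) (simp_all add: vec_eq_iff algebra_simps)
  then have "((*) m has_derivative (*) m) (at x)"
    by (rule linear_imp_has_derivative)
  from has_derivative_compose[OF this assms[unfolded gderiv_def]]
  have "((\<lambda>y. F (m * y)) has_derivative (\<lambda>h. (m * h) \<bullet> D)) (at x)" .
  \<comment> \<open>Multiplication by \<open>m\<close> is self-adjoint, so the factor passes from
    the direction to the gradient.\<close>
  moreover have "(m * h) \<bullet> D = h \<bullet> (m * D)" for h
    by (simp add: inner_vec_def mult_ac)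
  ultimately show ?thesis
    unfolding gderiv_def by simp
qed

lemma norm_times_le_l1_norm: "norm (m * w) \<le> l1_norm m * norm w"
proof -
  have "\<bar>m $ i\<bar> \<le> l1_norm m" for i
    unfolding l1_norm_def by (rule member_le_sum) auto
  then have "norm ((m * w) $ i) \<le> norm ((l1_norm m *\<^sub>R w) $ i)" for i
    using mult_right_mono[of "\<bar>m $ i\<bar>" "\<bar>l1_norm m\<bar>" "\<bar>w $ i\<bar>"]
    by (simp add: abs_mult order_trans[OF _ abs_ge_self])
  then have "norm (m * w) \<le> norm (l1_norm m *\<^sub>R w)"
    by (rule norm_le_componentwise_cart)
  \<comment> \<open>The norm of the scaled vector is \<open>\<bar>l1_norm m\<bar> * norm w\<close>;
    the sign removes the absolute value.\<close>
  moreover have "0 \<le> l1_norm m"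
    unfolding l1_norm_def by (rule sum_nonneg) simp
  ultimately show ?thesis
    by simp
qed

lemma softmax_pos: "0 < softmax z $ i"
  unfolding softmax_def by (simp add: sum_pos)

text \<open>Differentiability of \<open>ln\<close> composed with \<open>f\<close> at the masked
  point ensures that \<open>masked_log_grad\<close> is a genuine gradient, to which the chain rule
  for \<open>m * x\<close> then applies.\<close>

lemma gradient_loss:
  fixes f :: "real ^ 'n \<Rightarrow> real"
  assumes "f differentiable at (m * x)" and "0 < f (m * x)"
  shows "gradient (\<lambda>x. loss f x m) x = - (m * masked_log_grad f m x)"
proof -
  from assms(1) obtain f' where "(f has_derivative f') (at (m * x))"
    unfolding differentiable_def by blast
  with assms(2) have "(\<lambda>y. ln (f y)) differentiable at (m * x)"
    unfolding differentiable_def by (blast intro: has_derivative_ln)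
  then have "GDERIV (\<lambda>y. ln (f y)) (m * x) :> masked_log_grad f m x"
    unfolding masked_log_grad_def by (rule GDERIV_gradient)
  then have "GDERIV (\<lambda>x. ln (f (m * x))) x :> m * masked_log_grad f m x"
    by (rule GDERIV_compose_times)
  then have "GDERIV (\<lambda>x. loss f x m) x :> - (m * masked_log_grad f m x)"
    unfolding loss_def by (rule GDERIV_minus)
  then show ?thesis
    by (rule gradient_eqI)
qed

text \<open>Here \<open>g\<close> omits the chain rule factor \<open>m\<close>. With the full
  negative gradient of the loss in its place, both norms would coincide and the bound would fail
  whenever \<open>l1_norm m < 1\<close> and the two gradients differ.\<close>

theorem theorem2:
  fixes logits :: "real ^ 'd \<Rightarrow> real ^ 'k" and target :: 'k
    and f :: "real ^ 'd \<Rightarrow> real" and g :: "real ^ 'd \<Rightarrow> real ^ 'd"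
    and x\<^sub>0 m x\<^sub>i v :: "real ^ 'd" and D :: "(real ^ 'd) set" and \<epsilon> \<alpha> :: real
  assumes f: "f = (\<lambda>x. softmax (logits x) $ target)"
    and m: "\<forall>j. m $ j \<in> {0..1}"
    and eps: "\<epsilon> > 0"
    and vicinity: "\<forall>x\<in>D. norm (x - x\<^sub>0) \<le> \<epsilon>"
    and diff: "\<forall>x\<in>insert x\<^sub>0 D. f differentiable at (m * x)"
    and g: "g = masked_log_grad f m"
    and xi: "x\<^sub>i \<in> D"
    and alpha: "\<alpha> = norm (x\<^sub>i - x\<^sub>0)" and v: "norm v = 1" and decomp: "x\<^sub>i = x\<^sub>0 + \<alpha> *\<^sub>R v"
  shows "norm (gradient (\<lambda>x. loss f x m) x\<^sub>i - gradient (\<lambda>x. loss f x m) x\<^sub>0)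
           \<le> l1_norm m * norm (- g (x\<^sub>0 + \<alpha> *\<^sub>R v) + g x\<^sub>0)"
proof -
  \<comment> \<open>Positivity keeps the values of \<open>f\<close> where \<open>ln\<close> is
    differentiable.\<close>
  have "0 < f y" for y
    unfolding f by (rule softmax_pos)
  then have grad: "gradient (\<lambda>x. loss f x m) x = - (m * g x)" if "x \<in> insert x\<^sub>0 D" for x
    using gradient_loss diff that unfolding g by blast
  \<comment> \<open>Both gradients carry the same mask, so it factors out of the difference and the
    operator norm estimate applies.\<close>
  have "gradient (\<lambda>x. loss f x m) x\<^sub>i - gradient (\<lambda>x. loss f x m) x\<^sub>0 = m * (- g x\<^sub>i + g x\<^sub>0)"
    using grad[of x\<^sub>i] grad[of x\<^sub>0] xi by (simp add: vec_eq_iff algebra_simps)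
  then show ?thesis
    using norm_times_le_l1_norm[of m "- g x\<^sub>i + g x\<^sub>0"] decomp by simp
qed

end
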